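(* Let $\alpha=\{\alpha_1,\ldots,\alpha_p\}$ be any partition of $n$. Let $V_1=I$ and, for $t\ge1$, $V_{t+1}=\mathrm{chol}\big(C-\sum_{i=1}^m y_i^{t,\star}A_i\big)$, where $\{y_i^{t,\star},X_{kl}^{t,\star}\}$ is an optimal solution of the problem $(\mathrm{Out}_t)$ with matrix $V_t$, and let $\mathsf{L}_\alpha^t$ denote the optimal value of $(\mathrm{Out}_t)$. If, at iteration $t$, $C-\sum_{i=1}^m y_i^{t,\star}A_i$ is strictly positive definite and $\mathsf{L}^{t}_\alpha<d^\star$, then $$\mathsf{L}^{t}_\alpha<\mathsf{L}^{t+1}_\alpha\leq d^\star .$$
   Context: $\mathbb{S}^n$ is the set of real symmetric $n\times n$ matrices, $\mathbb{S}^n_+$ the set of positive semidefinite ones, $\langle A,B\rangle=\mathrm{tr}(AB)$ on $\mathbb{S}^n$. Problem data: $b\in\mathbb{R}^m$, $C,A_1,\ldots,A_m\in\mathbb{S}^n$. The primal and dual semidefinite programs are $$p^\star=\min_X\{\langle C,X\rangle : \langle A_i,X\rangle=b_i,\ i=1,\ldots,m,\ X\in\mathbb{S}^n_+\},$$ $$d^\star=\max_{y,Z}\{b^{\mathsf T}y : Z+\textstyle\sum_{i=1}^m A_iy_i=C,\ Z\in\mathbb{S}^n_+\},$$ and strong duality $p^\star=d^\star$ is assumed. A partition of $n$ is $\alpha=\{\alpha_1,\ldots,\alpha_p\}$ with positive integers $\alpha_i$, $\sum_{i=1}^p\alpha_i=n$. Let $E_i^\alpha=\begin{bmatrix}0&\cdots&I_{\alpha_i}&\cdots&0\end{bmatrix}\in\mathbb{R}^{\alpha_i\times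 n}$ (identity in the $i$-th block position) and, for $i\neq j$, $E_{ij}^\alpha=\begin{bmatrix}E_i^\alpha \\ E_j^\alpha\end{bmatrix}\in\mathbb{R}^{(\alpha_i+\alpha_j)\times n}$. Problem $(\mathrm{Out}_t)$ at iteration $t$, with matrix $V_t\in\mathbb{R}^{n\times n}$: $$\mathsf{L}_\alpha^t=\max_{y,X_{kl}}\ b^{\mathsf T}y\quad\text{subject to}\quad C-\sum_{i=1}^m y_iA_i=\sum_{1\le k<l\le p}V_t^{\mathsf T}(E_{kl}^\alpha)^{\mathsf T}X_{kl}E_{kl}^\alpha V_t,\quad X_{kl}\in\mathbb{S}^{\alpha_k+\alpha_l}_+,\ 1\le k<l\le p,$$ with $y\in\mathbb{R}^m$. (It is the dual of the outer approximation $\min_X\{\langle C,X\rangle:\langle A_i,X\rangle=b_i\ \forall i,\ E_{kl}^\alpha V_tXV_t^{\mathsf T}(E_{kl}^\alpha)^{\mathsf T}\in\mathbb{S}^{\alpha_k+\alpha_l}_+\ \forall k<l\}$ of the primal semidefinite program.) For $X\in\mathbb{S}^n_+$, $\mathrm{chol}(X)$ denotes a Cholesky factor of $X$, i.e. an upper triangular $V\in\mathbb{R}^{n\times n}$ with $X=V^{\mathsf T}V$. Optimal solutions $y^{t,\star}$ of the problems $(\mathrm{Out}_t)$ are assumed to exist, so that the sequence $\{V_t\}$ is well defined. *)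

theory Defs
  imports "Jordan_Normal_Form.Matrix" "HOL-Library.Extended_Real"
begin

text \<open>
  All index sets start at 0, so \<open>{1..n}\<close>, \<open>{1..m}\<close> and \<open>{1..p}\<close> become
  \<open>{..<n}\<close>, \<open>{..<m}\<close> and \<open>{..<p}\<close>.
\<close>

definition sym_mats :: "nat \<Rightarrow> real mat set" where
  "sym_mats n = {M \<in> carrier_mat n n. transpose_mat M = M}"

definition psd_mats :: "nat \<Rightarrow> real mat set" where
  "psd_mats n = {M \<in> sym_mats n. \<forall>v \<in> carrier_vec n. 0 \<le> v \<bullet> (M *\<^sub>v v)}"

definition pd_mats :: "nat \<Rightarrow> real mat set" where
  "pd_mats n = {M \<in> sym_mats n. \<forall>v \<in> carrier_vec n. v \<noteq> 0\<^sub>v n \<longrightarrow> 0 < v \<bullet> (M *\<^sub>v v)}"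

definition trace :: "real mat \<Rightarrow> real" where
  "trace M = (\<Sum>i<dim_row M. M $$ (i, i))"

definition mat_inner :: "real mat \<Rightarrow> real mat \<Rightarrow> real" where
  "mat_inner M N = trace (M * N)"

definition lin_comb :: "nat \<Rightarrow> nat \<Rightarrow> (nat \<Rightarrow> real mat) \<Rightarrow> real vec \<Rightarrow> real mat" where
  "lin_comb n m A y = finsum (module_mat TYPE(real) n n) (\<lambda>i. (y $ i) \<cdot>\<^sub>m A i) {..<m}"

definition primal_feasible ::
  "nat \<Rightarrow> nat \<Rightarrow> (nat \<Rightarrow> real mat) \<Rightarrow> real vec \<Rightarrow> real mat \<Rightarrow> bool" where
  "primal_feasible n m A b X \<longleftrightarrow>
     X \<in> psd_mats n \<and> (\<forall>i<m. mat_inner (A i) X = b $ i)"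

definition dual_feasible ::
  "nat \<Rightarrow> nat \<Rightarrow> (nat \<Rightarrow> real mat) \<Rightarrow> real mat \<Rightarrow> real vec \<Rightarrow> real mat \<Rightarrow> bool" where
  "dual_feasible n m A C y Z \<longleftrightarrow>
     y \<in> carrier_vec m \<and> Z \<in> psd_mats n \<and> Z + lin_comb n m A y = C"

text \<open>
  Optimal values are infima and suprema in the extended reals, so that they are
  defined without any assumption on attainment, feasibility or boundedness.
\<close>

definition primal_value ::
  "nat \<Rightarrow> nat \<Rightarrow> (nat \<Rightarrow> real mat) \<Rightarrow> real vec \<Rightarrow> real mat \<Rightarrow> ereal" where
  "primal_value n m A b C = Inf {ereal (mat_inner C X) | X. primal_feasible n m A b X}"

definition dual_value ::
  "nat \<Rightarrow> nat \<Rightarrow> (nat \<Rightarrow> real mat) \<Rightarrow> real vec \<Rightarrow> real mat \<Rightarrow> ereal" where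
  "dual_value n m A b C = Sup {ereal (b \<bullet> y) | y Z. dual_feasible n m A C y Z}"

text \<open>
  A partition is a list, since the order of its parts fixes the position of the blocks.
\<close>

definition partition_of :: "nat list \<Rightarrow> nat \<Rightarrow> bool" where
  "partition_of \<alpha> n \<longleftrightarrow> (\<forall>a\<in>set \<alpha>. 0 < a) \<and> sum_list \<alpha> = n"

definition block_E :: "nat list \<Rightarrow> nat \<Rightarrow> real mat" where
  "block_E \<alpha> i = mat (\<alpha> ! i) (sum_list \<alpha>)
     (\<lambda>(r, c). if c = sum_list (take i \<alpha>) + r then 1 else 0)"

definition block_EE :: "nat list \<Rightarrow> nat \<Rightarrow> nat \<Rightarrow> real mat" where
  "block_EE \<alpha> i j = block_E \<alpha> i @\<^sub>r block_E \<alpha> j"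

definition block_comb ::
  "nat \<Rightarrow> nat list \<Rightarrow> real mat \<Rightarrow> (nat \<Rightarrow> nat \<Rightarrow> real mat) \<Rightarrow> real mat" where
  "block_comb n \<alpha> V X =
     finsum (module_mat TYPE(real) n n)
       (\<lambda>(k, l). transpose_mat V * transpose_mat (block_EE \<alpha> k l) * X k l * block_EE \<alpha> k l * V)
       {(k, l). k < l \<and> l < length \<alpha>}"


definition out_feasible ::
  "nat \<Rightarrow> nat \<Rightarrow> (nat \<Rightarrow> real mat) \<Rightarrow> real mat \<Rightarrow> nat list \<Rightarrow> real mat \<Rightarrow>
   real vec \<Rightarrow> (nat \<Rightarrow> nat \<Rightarrow> real mat) \<Rightarrow> bool" where
  "out_feasible n m A C \<alpha> V y X \<longleftrightarrow>
     y \<in> carrier_vec m \<and>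
     (\<forall>k l. k < l \<and> l < length \<alpha> \<longrightarrow> X k l \<in> psd_mats (\<alpha> ! k + \<alpha> ! l)) \<and>
     C - lin_comb n m A y = block_comb n \<alpha> V X"

definition out_value ::
  "nat \<Rightarrow> nat \<Rightarrow> (nat \<Rightarrow> real mat) \<Rightarrow> real vec \<Rightarrow> real mat \<Rightarrow> nat list \<Rightarrow> real mat \<Rightarrow> ereal" where
  "out_value n m A b C \<alpha> V = Sup {ereal (b \<bullet> y) | y X. out_feasible n m A C \<alpha> V y X}"

definition out_optimal ::
  "nat \<Rightarrow> nat \<Rightarrow> (nat \<Rightarrow> real mat) \<Rightarrow> real vec \<Rightarrow> real mat \<Rightarrow> nat list \<Rightarrow> real mat \<Rightarrow>
   real vec \<Rightarrow> (nat \<Rightarrow> nat \<Rightarrow> real mat) \<Rightarrow> bool" where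
  "out_optimal n m A b C \<alpha> V y X \<longleftrightarrow>
     out_feasible n m A C \<alpha> V y X \<and>
     (\<forall>y' X'. out_feasible n m A C \<alpha> V y' X' \<longrightarrow> b \<bullet> y' \<le> b \<bullet> y)"

text \<open>
  A relation rather than a function: the factor is not unique, as no sign condition
  is put on the diagonal of \<open>V\<close>.
\<close>

definition cholesky_factor :: "nat \<Rightarrow> real mat \<Rightarrow> real mat \<Rightarrow> bool" where
  "cholesky_factor n M V \<longleftrightarrow>
     V \<in> carrier_mat n n \<and> upper_triangular V \<and> M = transpose_mat V * V"

end

theory Submission
  imports Defs "Jordan_Normal_Form.Determinant"
begin

text \<open>
  Write \<open>M = C - \<Sum> y\<^sub>i A\<^sub>i\<close> for the slack at the optimal \<open>y\<close> of the current outer problem, and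
  \<open>M = V\<^sup>T V\<close> for its Cholesky factorisation, so that \<open>V\<close> is the matrix of the next problem. Every
  outer-feasible slack is a sum of congruences of positive semidefinite matrices, hence
  positive semidefinite; this gives the upper bound by the dual value.

  For the strict increase, pick a dual feasible \<open>y'\<close> with slack \<open>Z\<close> and a larger objective, and
  move from \<open>y\<close> towards \<open>y'\<close> by a small step \<open>\<epsilon>\<close>. The objective strictly grows. Since \<open>M\<close> is
  positive definite, \<open>V\<close> is invertible, so \<open>Z = V\<^sup>T W V\<close> with \<open>W = V\<^sup>-\<^sup>T Z V\<^sup>-\<^sup>1\<close>, and the slack of
  the shifted point is \<open>V\<^sup>T ((1 - \<epsilon>) I + \<epsilon> W) V\<close>. In the coordinates of the next problem the
  current point is thus the identity, and it remains to see that the identity is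
  an interior point of the cone of sums of positive semidefinite matrices supported on pairs
  of blocks (\<open>near_identity_block_comb\<close>). That holds because a matrix \<open>N\<close> is the sum of the
  pairwise principal submatrices of the matrix \<open>B\<close> obtained by dividing the diagonal blocks of
  \<open>N\<close> by \<open>p - 1\<close> (\<open>block_comb_compress\<close>): an off-diagonal entry lies in one pair of blocks,
  an entry of a diagonal block in \<open>p - 1\<close> of them. If \<open>N\<close> is close to the identity, then \<open>B\<close> is
  close to a positive multiple of the identity, so it is positive semidefinite
  together with all its principal submatrices.

  This argument needs two blocks. With a single block the outer problem forces the slack to be
  zero, contradicting positive definiteness; with no block, \<open>n = 0\<close> and the outer problem
  coincides with the dual.
\<close>

section \<open>Sums of matrices\<close>

lemma finsum_mat:
  fixes f :: "'c \<Rightarrow> real mat"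
  assumes "finite F" and "\<And>x. x \<in> F \<Longrightarrow> f x \<in> carrier_mat n n"
  shows finsum_mat_carrier: "finsum (module_mat TYPE(real) n n) f F \<in> carrier_mat n n"
    and index_finsum_mat: "i < n \<Longrightarrow> j < n \<Longrightarrow>
      finsum (module_mat TYPE(real) n n) f F $$ (i, j) = (\<Sum>x\<in>F. f x $$ (i, j))"
proof -
  interpret abelian_group "module_mat TYPE(real) n n"
    by (rule abelian_group_mat)
  have "finsum (module_mat TYPE(real) n n) f F \<in> carrier_mat n n \<and>
    (i < n \<longrightarrow> j < n \<longrightarrow> finsum (module_mat TYPE(real) n n) f F $$ (i, j) = (\<Sum>x\<in>F. f x $$ (i, j)))"
    using assms
  proof (induction F)
    case empty
    show ?case by (simp add: module_mat_simps)
  next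
    case (insert x F)
    have "f \<in> F \<rightarrow> carrier (module_mat TYPE(real) n n)" "f x \<in> carrier (module_mat TYPE(real) n n)"
      using insert.prems by (auto simp: module_mat_simps)
    from finsum_insert[OF insert.hyps this]
    have "finsum (module_mat TYPE(real) n n) f (insert x F)
      = f x + finsum (module_mat TYPE(real) n n) f F"
      by (simp add: module_mat_simps)
    with insert show ?case by auto
  qed
  then show "finsum (module_mat TYPE(real) n n) f F \<in> carrier_mat n n"
    and "i < n \<Longrightarrow> j < n \<Longrightarrow>
      finsum (module_mat TYPE(real) n n) f F $$ (i, j) = (\<Sum>x\<in>F. f x $$ (i, j))"
    by auto
qed

lemma index_mult_mat_sum:
  assumes "P \<in> carrier_mat a b" "Q \<in> carrier_mat b c" "i < a" "j < c"
  shows "(P * Q) $$ (i, j) = (\<Sum>x<b. P $$ (i, x) * Q $$ (x, j))"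
  using assms by (auto simp: scalar_prod_def atLeast0LessThan intro!: sum.cong)

lemma index_mult3_mat_sum:
  assumes "P \<in> carrier_mat a b" "Q \<in> carrier_mat b c" "R \<in> carrier_mat c d" "i < a" "j < d"
  shows "(P * Q * R) $$ (i, j) = (\<Sum>y<c. \<Sum>x<b. P $$ (i, x) * Q $$ (x, y) * R $$ (y, j))"
proof -
  have "(P * Q * R) $$ (i, j) = (\<Sum>y<c. (P * Q) $$ (i, y) * R $$ (y, j))"
    using assms by (intro index_mult_mat_sum[of _ a]) auto
  also have "\<dots> = (\<Sum>y<c. (\<Sum>x<b. P $$ (i, x) * Q $$ (x, y)) * R $$ (y, j))"
    using assms by (intro sum.cong) (auto simp: index_mult_mat_sum[of _ a b _ c] simp del: index_mult_mat)
  finally show ?thesis by (simp add: sum_distrib_right)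
qed

lemma finsum_mat_congruence:
  fixes f :: "'c \<Rightarrow> real mat"
  assumes "finite F" and f: "\<And>x. x \<in> F \<Longrightarrow> f x \<in> carrier_mat n n" and V: "V \<in> carrier_mat n n"
  shows "finsum (module_mat TYPE(real) n n) (\<lambda>x. transpose_mat V * f x * V) F
    = transpose_mat V * finsum (module_mat TYPE(real) n n) f F * V" (is "?L = ?R")
proof (rule eq_matI)
  have T: "transpose_mat V \<in> carrier_mat n n" using V by simp
  have c: "\<And>x. x \<in> F \<Longrightarrow> transpose_mat V * f x * V \<in> carrier_mat n n"
    using f V by (meson T mult_carrier_mat)
  have S: "finsum (module_mat TYPE(real) n n) f F \<in> carrier_mat n n"
    by (rule finsum_mat_carrier[OF assms(1) f])
  have L: "?L \<in> carrier_mat n n" by (rule finsum_mat_carrier[OF assms(1) c])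
  have R: "?R \<in> carrier_mat n n" using T S V by (meson mult_carrier_mat)
  show "dim_row ?L = dim_row ?R" "dim_col ?L = dim_col ?R" using L R by auto
  fix i j assume "i < dim_row ?R" "j < dim_col ?R"
  then have ij: "i < n" "j < n" using R by auto
  have "?L $$ (i, j) = (\<Sum>z\<in>F. (transpose_mat V * f z * V) $$ (i, j))"
    by (rule index_finsum_mat[OF assms(1) c ij])
  also have "\<dots> = (\<Sum>z\<in>F. \<Sum>y<n. \<Sum>x<n. transpose_mat V $$ (i, x) * f z $$ (x, y) * V $$ (y, j))"
    by (intro sum.cong refl index_mult3_mat_sum[OF T f V ij])
  also have "\<dots> = (\<Sum>y<n. \<Sum>x<n. \<Sum>z\<in>F. transpose_mat V $$ (i, x) * f z $$ (x, y) * V $$ (y, j))"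
    by (subst sum.swap, intro sum.cong refl, subst sum.swap, rule refl)
  also have "\<dots> = (\<Sum>y<n. \<Sum>x<n. transpose_mat V $$ (i, x)
      * finsum (module_mat TYPE(real) n n) f F $$ (x, y) * V $$ (y, j))"
    by (intro sum.cong refl)
      (simp add: index_finsum_mat[OF assms(1) f] sum_distrib_left sum_distrib_right)
  also have "\<dots> = ?R $$ (i, j)" by (rule index_mult3_mat_sum[OF T S V ij, symmetric])
  finally show "?L $$ (i, j) = ?R $$ (i, j)" .
qed

lemma lin_comb_carrier:
  assumes "\<And>i. i < m \<Longrightarrow> A i \<in> sym_mats n"
  shows "lin_comb n m A y \<in> carrier_mat n n"
  unfolding lin_comb_def using assms by (intro finsum_mat_carrier) (auto simp: sym_mats_def)

lemma index_lin_comb: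
  assumes A: "\<And>i. i < m \<Longrightarrow> A i \<in> sym_mats n" and "i < n" "j < n"
  shows "lin_comb n m A y $$ (i, j) = (\<Sum>k<m. y $ k * A k $$ (i, j))"
proof -
  have c: "A k \<in> carrier_mat n n" if "k < m" for k using A[OF that] by (simp add: sym_mats_def)
  have "lin_comb n m A y $$ (i, j) = (\<Sum>k<m. (y $ k \<cdot>\<^sub>m A k) $$ (i, j))"
    unfolding lin_comb_def using c assms(2,3) by (intro index_finsum_mat) auto
  also have "\<dots> = (\<Sum>k<m. y $ k * A k $$ (i, j))"
    using c assms(2,3) by (intro sum.cong) (auto dest: c)
  finally show ?thesis .
qed

section \<open>Positive semidefinite matrices\<close>

lemma quadratic_form_sum:
  fixes M :: "real mat"
  assumes "M \<in> carrier_mat n n" "v \<in> carrier_vec n"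
  shows "v \<bullet> (M *\<^sub>v v) = (\<Sum>i<n. \<Sum>j<n. v $ i * M $$ (i, j) * v $ j)"
  using assms by (auto simp: scalar_prod_def atLeast0LessThan sum_distrib_left mult.assoc intro!: sum.cong)

lemma sym_mats_iff:
  "M \<in> sym_mats n \<longleftrightarrow> M \<in> carrier_mat n n \<and> (\<forall>i<n. \<forall>j<n. M $$ (i, j) = M $$ (j, i))"
proof (cases "M \<in> carrier_mat n n")
  case True
  have "transpose_mat M = M \<longleftrightarrow> (\<forall>i<n. \<forall>j<n. M $$ (i, j) = M $$ (j, i))"
  proof
    assume "transpose_mat M = M"
    then show "\<forall>i<n. \<forall>j<n. M $$ (i, j) = M $$ (j, i)"
      using True by (metis carrier_matD index_transpose_mat(1))
  next
    assume "\<forall>i<n. \<forall>j<n. M $$ (i, j) = M $$ (j, i)"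
    then show "transpose_mat M = M" using True by (intro eq_matI) auto
  qed
  with True show ?thesis by (simp add: sym_mats_def)
qed (simp add: sym_mats_def)

lemma sym_mats_congruence:
  assumes "M \<in> sym_mats n" "B \<in> carrier_mat n k"
  shows "transpose_mat B * M * B \<in> sym_mats k"
proof -
  have M: "M \<in> carrier_mat n n" "transpose_mat M = M" using assms by (auto simp: sym_mats_def)
  have "transpose_mat (transpose_mat B * M * B) = transpose_mat B * transpose_mat (transpose_mat B * M)"
    by (rule transpose_mult[of _ k n]) (use M assms in auto)
  also have "transpose_mat (transpose_mat B * M) = M * B"
    using transpose_mult[of "transpose_mat B" k n M n] M assms by simp
  also have "transpose_mat B * (M * B) = transpose_mat B * M * B"
    using M assms by (intro assoc_mult_mat[symmetric]) auto
  finally show ?thesis using M assms by (simp add: sym_mats_def)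
qed

lemma psd_mats_congruence:
  assumes "M \<in> psd_mats n" "B \<in> carrier_mat n k"
  shows "transpose_mat B * M * B \<in> psd_mats k"
proof -
  have M: "M \<in> sym_mats n" "M \<in> carrier_mat n n" using assms by (auto simp: psd_mats_def sym_mats_def)
  have "0 \<le> v \<bullet> (transpose_mat B * M * B *\<^sub>v v)" if v: "v \<in> carrier_vec k" for v
  proof -
    have Bv: "B *\<^sub>v v \<in> carrier_vec n" using assms v by simp
    have T: "transpose_mat B \<in> carrier_mat k n" using assms(2) by simp
    have "transpose_mat B * M * B *\<^sub>v v = transpose_mat B * M *\<^sub>v (B *\<^sub>v v)"
      by (rule assoc_mult_mat_vec[OF mult_carrier_mat[OF T M(2)] assms(2) v])
    also have "\<dots> = transpose_mat B *\<^sub>v (M *\<^sub>v (B *\<^sub>v v))"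
      by (rule assoc_mult_mat_vec[OF T M(2) Bv])
    finally have "v \<bullet> (transpose_mat B * M * B *\<^sub>v v)
      = v \<bullet> (transpose_mat B *\<^sub>v (M *\<^sub>v (B *\<^sub>v v)))" by simp
    also have "\<dots> = (transpose_mat B *\<^sub>v (M *\<^sub>v (B *\<^sub>v v))) \<bullet> v"
      using assms M v Bv by (intro comm_scalar_prod[of _ k]) auto
    also have "\<dots> = (M *\<^sub>v (B *\<^sub>v v)) \<bullet> (B *\<^sub>v v)"
      using assms M v Bv by (intro transpose_vec_mult_scalar) auto
    also have "\<dots> = (B *\<^sub>v v) \<bullet> (M *\<^sub>v (B *\<^sub>v v))"
      using M Bv by (intro comm_scalar_prod[of _ n]) auto
    finally show ?thesis using assms(1) Bv by (simp add: psd_mats_def)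
  qed
  with sym_mats_congruence[OF M(1) assms(2)] show ?thesis by (simp add: psd_mats_def)
qed

lemma psd_mats_finsum:
  fixes f :: "'c \<Rightarrow> real mat"
  assumes "finite F" and f: "\<And>x. x \<in> F \<Longrightarrow> f x \<in> psd_mats n"
  shows "finsum (module_mat TYPE(real) n n) f F \<in> psd_mats n" (is "?S \<in> _")
proof -
  have fs: "\<And>x. x \<in> F \<Longrightarrow> f x \<in> sym_mats n" using f by (auto simp: psd_mats_def)
  have fc: "\<And>x. x \<in> F \<Longrightarrow> f x \<in> carrier_mat n n" using fs by (auto simp: sym_mats_def)
  have S: "?S \<in> carrier_mat n n" by (rule finsum_mat_carrier[OF assms(1) fc])
  note ix = index_finsum_mat[OF assms(1) fc]
  have "?S \<in> sym_mats n"
    unfolding sym_mats_iff using S fs by (auto simp: ix sym_mats_iff intro!: sum.cong)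
  moreover have "0 \<le> v \<bullet> (?S *\<^sub>v v)" if v: "v \<in> carrier_vec n" for v
  proof -
    have "v \<bullet> (?S *\<^sub>v v) = (\<Sum>i<n. \<Sum>j<n. \<Sum>x\<in>F. v $ i * f x $$ (i, j) * v $ j)"
      by (simp add: quadratic_form_sum[OF S v] ix sum_distrib_left sum_distrib_right)
    also have "\<dots> = (\<Sum>i<n. \<Sum>x\<in>F. \<Sum>j<n. v $ i * f x $$ (i, j) * v $ j)"
      by (intro sum.cong refl sum.swap)
    also have "\<dots> = (\<Sum>x\<in>F. \<Sum>i<n. \<Sum>j<n. v $ i * f x $$ (i, j) * v $ j)"
      by (rule sum.swap)
    also have "\<dots> = (\<Sum>x\<in>F. v \<bullet> (f x *\<^sub>v v))"
      by (intro sum.cong refl) (simp add: quadratic_form_sum[OF fc v])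
    also have "\<dots> \<ge> 0" using f v by (intro sum_nonneg) (auto simp: psd_mats_def)
    finally show ?thesis .
  qed
  ultimately show ?thesis by (simp add: psd_mats_def)
qed

text \<open>
  The entrywise norm bounds the quadratic form, because
  \<open>\<bar>v\<^sub>i v\<^sub>j\<bar> \<le> (v\<^sub>i\<^sup>2 + v\<^sub>j\<^sup>2) / 2 \<le> v \<bullet> v\<close>. A crude bound suffices here, as only some neighbourhood
  of the identity is wanted.
\<close>

lemma psd_mats_scaled_id_add:
  fixes W :: "real mat"
  assumes W: "W \<in> sym_mats n" and c: "(\<Sum>i<n. \<Sum>j<n. \<bar>W $$ (i, j)\<bar>) \<le> c"
  shows "c \<cdot>\<^sub>m 1\<^sub>m n + W \<in> psd_mats n" (is "?M \<in> _")
proof -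
  have Wc: "W \<in> carrier_mat n n" using W by (simp add: sym_mats_def)
  then have M: "?M \<in> carrier_mat n n" by simp
  have "?M \<in> sym_mats n" using W unfolding sym_mats_iff by auto
  moreover have "0 \<le> v \<bullet> (?M *\<^sub>v v)" if v: "v \<in> carrier_vec n" for v
  proof -
    define q where "q = (\<Sum>i<n. v $ i * v $ i)"
    have sq: "v $ i * v $ i \<le> q" if "i < n" for i
      unfolding q_def using that by (intro member_le_sum) auto
    have q0: "0 \<le> q" unfolding q_def by (intro sum_nonneg) auto
    have cross: "\<bar>v $ i * v $ j\<bar> \<le> q" if "i < n" "j < n" for i j
    proof -
      have "2 * \<bar>v $ i * v $ j\<bar> \<le> v $ i * v $ i + v $ j * v $ j"
        using sum_squares_bound[of "\<bar>v $ i\<bar>" "\<bar>v $ j\<bar>"]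
        by (simp add: abs_mult power2_eq_square)
      then show ?thesis using sq[OF that(1)] sq[OF that(2)] by linarith
    qed
    have "v \<bullet> (?M *\<^sub>v v)
      = (\<Sum>i<n. \<Sum>j<n. (if i = j then c * (v $ i * v $ j) else 0) + v $ i * W $$ (i, j) * v $ j)"
      unfolding quadratic_form_sum[OF M v] using Wc by (intro sum.cong) (auto simp: algebra_simps)
    also have "\<dots> = c * q + (\<Sum>i<n. \<Sum>j<n. v $ i * W $$ (i, j) * v $ j)"
      by (simp add: sum.distrib q_def sum_distrib_left)
    finally have eq: "v \<bullet> (?M *\<^sub>v v) = c * q + (\<Sum>i<n. \<Sum>j<n. v $ i * W $$ (i, j) * v $ j)" .
    have "- (\<Sum>i<n. \<Sum>j<n. v $ i * W $$ (i, j) * v $ j)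
      = (\<Sum>i<n. \<Sum>j<n. - (W $$ (i, j) * (v $ i * v $ j)))"
      by (simp add: sum_negf mult_ac)
    also have "\<dots> \<le> (\<Sum>i<n. \<Sum>j<n. \<bar>W $$ (i, j)\<bar> * q)"
    proof (intro sum_mono)
      fix i j assume "i \<in> {..<n}" "j \<in> {..<n}"
      then have "\<bar>W $$ (i, j)\<bar> * \<bar>v $ i * v $ j\<bar> \<le> \<bar>W $$ (i, j)\<bar> * q"
        by (intro mult_left_mono cross) auto
      then show "- (W $$ (i, j) * (v $ i * v $ j)) \<le> \<bar>W $$ (i, j)\<bar> * q"
        by (metis abs_ge_minus_self abs_mult order_trans)
    qed
    also have "\<dots> = (\<Sum>i<n. \<Sum>j<n. \<bar>W $$ (i, j)\<bar>) * q"
      by (simp add: sum_distrib_right)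
    also have "\<dots> \<le> c * q" using c q0 by (rule mult_right_mono)
    finally show ?thesis unfolding eq by linarith
  qed
  ultimately show ?thesis by (simp add: psd_mats_def)
qed

lemma cholesky_factor_invertible:
  assumes M: "M \<in> pd_mats n" and V: "cholesky_factor n M V"
  shows "\<exists>U \<in> carrier_mat n n. V * U = 1\<^sub>m n \<and> U * V = 1\<^sub>m n"
proof -
  have Vc: "V \<in> carrier_mat n n" and MV: "M = transpose_mat V * V"
    using V by (auto simp: cholesky_factor_def)
  have "det V \<noteq> 0"
  proof
    assume "det V = 0"
    then obtain v where v: "v \<in> carrier_vec n" "v \<noteq> 0\<^sub>v n" "V *\<^sub>v v = 0\<^sub>v n"
      using det_0_iff_vec_prod_zero_field[OF Vc] by auto
    have "M *\<^sub>v v = transpose_mat V *\<^sub>v (V *\<^sub>v v)"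
      unfolding MV using Vc v(1) by (intro assoc_mult_mat_vec) auto
    also have "\<dots> = 0\<^sub>v n" unfolding v(3) using Vc by (intro eq_vecI) auto
    finally have "v \<bullet> (M *\<^sub>v v) = 0" using v(1) by simp
    moreover have "0 < v \<bullet> (M *\<^sub>v v)" using M v by (simp add: pd_mats_def)
    ultimately show False by simp
  qed
  from det_non_zero_imp_unit[OF Vc this, of undefined]
  show ?thesis by (auto simp: Units_def ring_mat_def)
qed

section \<open>Pairs of blocks\<close>

text \<open>
  Recursion on the parts makes it easy to see that every index lies in exactly one block.
\<close>

fun block_of :: "nat list \<Rightarrow> nat \<Rightarrow> nat" where
  "block_of [] i = 0"
| "block_of (a # \<alpha>) i = (if i < a then 0 else Suc (block_of \<alpha> (i - a)))"

lemma block_of_less: "i < sum_list \<alpha> \<Longrightarrow> block_of \<alpha> i < length \<alpha>"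
  by (induction \<alpha> arbitrary: i) auto

lemma block_of_eq_iff:
  "i < sum_list \<alpha> \<Longrightarrow> k < length \<alpha> \<Longrightarrow>
   block_of \<alpha> i = k \<longleftrightarrow> sum_list (take k \<alpha>) \<le> i \<and> i < sum_list (take k \<alpha>) + \<alpha> ! k"
proof (induction \<alpha> arbitrary: i k)
  case (Cons a \<alpha>)
  show ?case
  proof (cases k)
    case (Suc k')
    then show ?thesis using Cons.IH[of "i - a" k'] Cons.prems by auto
  qed auto
qed simp

lemma block_E_carrier: "block_E \<alpha> k \<in> carrier_mat (\<alpha> ! k) (sum_list \<alpha>)"
  by (simp add: block_E_def)

lemma block_EE_carrier: "block_EE \<alpha> k l \<in> carrier_mat (\<alpha> ! k + \<alpha> ! l) (sum_list \<alpha>)"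
  unfolding block_EE_def by (rule carrier_append_rows[OF block_E_carrier block_E_carrier])

lemma sum_lessThan_add:
  fixes f :: "nat \<Rightarrow> 'a :: comm_monoid_add"
  shows "(\<Sum>r<a + b. f r) = (\<Sum>r<a. f r) + (\<Sum>r<b. f (a + r))"
  by (induction b) (simp_all add: add.assoc)

lemma block_E_gram:
  assumes "i < sum_list \<alpha>" "j < sum_list \<alpha>" "k < length \<alpha>"
  shows "(\<Sum>r<\<alpha> ! k. block_E \<alpha> k $$ (r, i) * block_E \<alpha> k $$ (r, j))
    = (if i = j \<and> block_of \<alpha> i = k then 1 else 0)"
proof -
  let ?s = "sum_list (take k \<alpha>)"
  have "(\<Sum>r<\<alpha> ! k. block_E \<alpha> k $$ (r, i) * block_E \<alpha> k $$ (r, j))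
    = (\<Sum>r<\<alpha> ! k. if r = i - ?s then (if ?s \<le> i \<and> i = j then 1 else 0) else 0)"
    using assms by (intro sum.cong) (auto simp: block_E_def)
  also have "\<dots> = (if i = j \<and> block_of \<alpha> i = k then 1 else 0)"
    unfolding sum.delta[OF finite_lessThan] using block_of_eq_iff[OF assms(1,3)] by auto
  finally show ?thesis .
qed

text \<open>
  \<open>E\<^sub>k\<^sub>l\<^sup>T E\<^sub>k\<^sub>l\<close> is the coordinate projection onto the two blocks; the blocks \<open>k\<close> and \<open>l\<close> must
  differ, since otherwise their common coordinates would be counted twice.
\<close>

lemma block_EE_gram:
  assumes "k < length \<alpha>" "l < length \<alpha>" "k \<noteq> l"
  shows "transpose_mat (block_EE \<alpha> k l) * block_EE \<alpha> k l
    = mat (sum_list \<alpha>) (sum_list \<alpha>) (\<lambda>(i, j). if i = j \<and> block_of \<alpha> i \<in> {k, l} then 1 else 0)"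
    (is "?L = ?R")
proof (rule eq_matI)
  note EE = block_EE_carrier[of \<alpha> k l]
  show "dim_row ?L = dim_row ?R" "dim_col ?L = dim_col ?R" using EE by auto
  fix i j assume "i < dim_row ?R" "j < dim_col ?R"
  then have ij: "i < sum_list \<alpha>" "j < sum_list \<alpha>" by auto
  have ix: "block_EE \<alpha> k l $$ (r, c) = (if r < \<alpha> ! k then block_E \<alpha> k $$ (r, c)
      else block_E \<alpha> l $$ (r - \<alpha> ! k, c))"
    if "r < \<alpha> ! k + \<alpha> ! l" "c < sum_list \<alpha>" for r c
    using that block_E_carrier[of \<alpha> k] block_E_carrier[of \<alpha> l]
    by (auto simp: block_EE_def append_rows_def)
  have "?L $$ (i, j) = (\<Sum>r<\<alpha> ! k + \<alpha> ! l. block_EE \<alpha> k l $$ (r, i) * block_EE \<alpha> k l $$ (r, j))"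
    using ij EE by (subst index_mult_mat_sum[of _ "sum_list \<alpha>" "\<alpha> ! k + \<alpha> ! l" _ "sum_list \<alpha>"])
      (auto intro!: sum.cong)
  also have "\<dots> = (\<Sum>r<\<alpha> ! k. block_EE \<alpha> k l $$ (r, i) * block_EE \<alpha> k l $$ (r, j))
     + (\<Sum>r<\<alpha> ! l. block_EE \<alpha> k l $$ (\<alpha> ! k + r, i) * block_EE \<alpha> k l $$ (\<alpha> ! k + r, j))"
    by (rule sum_lessThan_add)
  also have "\<dots> = (\<Sum>r<\<alpha> ! k. block_E \<alpha> k $$ (r, i) * block_E \<alpha> k $$ (r, j))
     + (\<Sum>r<\<alpha> ! l. block_E \<alpha> l $$ (r, i) * block_E \<alpha> l $$ (r, j))"
    using ij by (intro arg_cong2[where f = "(+)"] sum.cong) (auto simp: ix)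
  also have "\<dots> = ?R $$ (i, j)"
    using ij assms by (auto simp: block_E_gram)
  finally show "?L $$ (i, j) = ?R $$ (i, j)" .
qed

lemma block_EE_compress:
  assumes "k < length \<alpha>" "l < length \<alpha>" "k \<noteq> l"
    and B: "B \<in> carrier_mat (sum_list \<alpha>) (sum_list \<alpha>)"
  shows "transpose_mat (block_EE \<alpha> k l) * (block_EE \<alpha> k l * B * transpose_mat (block_EE \<alpha> k l))
      * block_EE \<alpha> k l
    = mat (sum_list \<alpha>) (sum_list \<alpha>)
        (\<lambda>(i, j). if block_of \<alpha> i \<in> {k, l} \<and> block_of \<alpha> j \<in> {k, l} then B $$ (i, j) else 0)"
proof -
  let ?n = "sum_list \<alpha>" and ?q = "\<alpha> ! k + \<alpha> ! l" and ?E = "block_EE \<alpha> k l"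
  let ?P = "mat ?n ?n (\<lambda>(i, j). if i = j \<and> block_of \<alpha> i \<in> {k, l} then 1 else 0 :: real)"
  have E: "?E \<in> carrier_mat ?q ?n" "transpose_mat ?E \<in> carrier_mat ?n ?q"
    using block_EE_carrier[of \<alpha> k l] by auto
  have c1: "?E * B \<in> carrier_mat ?q ?n" using E B by auto
  have c2: "?E * B * transpose_mat ?E \<in> carrier_mat ?q ?q" using c1 E by auto
  have c3: "transpose_mat ?E * ?E \<in> carrier_mat ?n ?n" using E by auto
  have "transpose_mat ?E * (?E * B * transpose_mat ?E) * ?E
    = transpose_mat ?E * (?E * B * transpose_mat ?E * ?E)"
    by (rule assoc_mult_mat[OF E(2) c2 E(1)])
  also have "?E * B * transpose_mat ?E * ?E = ?E * B * (transpose_mat ?E * ?E)"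
    by (rule assoc_mult_mat[OF c1 E(2) E(1)])
  also have "transpose_mat ?E * (?E * B * (transpose_mat ?E * ?E))
    = transpose_mat ?E * (?E * B) * (transpose_mat ?E * ?E)"
    by (rule assoc_mult_mat[OF E(2) c1 c3, symmetric])
  also have "transpose_mat ?E * (?E * B) = (transpose_mat ?E * ?E) * B"
    by (rule assoc_mult_mat[OF E(2) E(1) B, symmetric])
  also have "transpose_mat ?E * ?E = ?P" by (rule block_EE_gram[OF assms(1-3)])
  also have "?P * B * ?P = mat ?n ?n
      (\<lambda>(i, j). if block_of \<alpha> i \<in> {k, l} \<and> block_of \<alpha> j \<in> {k, l} then B $$ (i, j) else 0)"
    (is "_ = ?R")
  proof (rule eq_matI)
    show "dim_row (?P * B * ?P) = dim_row ?R" "dim_col (?P * B * ?P) = dim_col ?R" by auto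
    fix i j assume "i < dim_row ?R" "j < dim_col ?R"
    then have ij: "i < ?n" "j < ?n" by auto
    have "(?P * B * ?P) $$ (i, j) = (\<Sum>y<?n. \<Sum>x<?n. ?P $$ (i, x) * B $$ (x, y) * ?P $$ (y, j))"
      using B ij by (intro index_mult3_mat_sum[of _ ?n]) auto
    also have "\<dots> = (\<Sum>y<?n. \<Sum>x<?n. if x = i then
        (if block_of \<alpha> i \<in> {k, l} then B $$ (x, y) * ?P $$ (y, j) else 0) else 0)"
      using ij by (intro sum.cong) auto
    also have "\<dots> = (\<Sum>y<?n. if block_of \<alpha> i \<in> {k, l} then B $$ (i, y) * ?P $$ (y, j) else 0)"
      using ij by simp
    also have "\<dots> = (\<Sum>y<?n. if y = j then
        (if block_of \<alpha> i \<in> {k, l} \<and> block_of \<alpha> j \<in> {k, l} then B $$ (i, y) else 0) else 0)"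
      using ij by (intro sum.cong) auto
    also have "\<dots> = ?R $$ (i, j)" using ij by simp
    finally show "(?P * B * ?P) $$ (i, j) = ?R $$ (i, j)" .
  qed
  finally show ?thesis .
qed

lemma finite_pairs: "finite {(k, l). k < l \<and> l < (p :: nat)}"
  by (rule finite_subset[of _ "{..<p} \<times> {..<p}"]) auto

lemma card_pairs_containing:
  fixes p :: nat
  assumes "a < p" "b < p"
  shows "card {(k, l). k < l \<and> l < p \<and> a \<in> {k, l} \<and> b \<in> {k, l}} = (if a = b then p - 1 else 1)"
proof (cases "a = b")
  case True
  \<comment> \<open>A pair containing \<open>a\<close> is determined by its other member \<open>c\<close>.\<close>
  have "bij_betw (\<lambda>c. (min a c, max a c)) ({..<p} - {a})
      {(k, l). k < l \<and> l < p \<and> a \<in> {k, l} \<and> b \<in> {k, l}}"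
  proof (rule bij_betwI[where g = "\<lambda>(k, l). if k = a then l else k"])
    show "(\<lambda>c. (min a c, max a c)) \<in> {..<p} - {a} \<rightarrow>
        {(k, l). k < l \<and> l < p \<and> a \<in> {k, l} \<and> b \<in> {k, l}}"
      using assms True by (auto simp: min_def max_def)
  qed (use assms True in \<open>auto simp: min_def max_def\<close>)
  from bij_betw_same_card[OF this] show ?thesis using assms True by (simp add: card_Diff_singleton)
next
  case False
  then have "{(k, l). k < l \<and> l < p \<and> a \<in> {k, l} \<and> b \<in> {k, l}} = {(min a b, max a b)}"
    using assms by (auto simp: min_def max_def)
  with False show ?thesis by simp
qed

lemma block_comb_eq_congruence:
  assumes "sum_list \<alpha> = n" and V: "V \<in> carrier_mat n n"
    and X: "\<And>k l. k < l \<Longrightarrow> l < length \<alpha> \<Longrightarrow> X k l \<in> carrier_mat (\<alpha> ! k + \<alpha> ! l) (\<alpha> ! k + \<alpha> ! l)"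
  shows "block_comb n \<alpha> V X = transpose_mat V * finsum (module_mat TYPE(real) n n)
      (\<lambda>(k, l). transpose_mat (block_EE \<alpha> k l) * X k l * block_EE \<alpha> k l)
      {(k, l). k < l \<and> l < length \<alpha>} * V"
proof -
  interpret abelian_group "module_mat TYPE(real) n n" by (rule abelian_group_mat)
  let ?I = "{(k, l). k < l \<and> l < length \<alpha>}"
  let ?f = "\<lambda>(k, l). transpose_mat (block_EE \<alpha> k l) * X k l * block_EE \<alpha> k l"
  have EE: "block_EE \<alpha> k l \<in> carrier_mat (\<alpha> ! k + \<alpha> ! l) n" for k l
    using block_EE_carrier[of \<alpha> k l] assms(1) by simp
  have f: "?f x \<in> carrier_mat n n" if "x \<in> ?I" for x
    using that EE X by (fastforce intro!: mult_carrier_mat)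
  have "block_comb n \<alpha> V X = finsum (module_mat TYPE(real) n n)
      (\<lambda>x. transpose_mat V * ?f x * V) ?I"
    unfolding block_comb_def
  proof (rule finsum_cong'[OF refl])
    have "transpose_mat V * transpose_mat (block_EE \<alpha> k l) * X k l * block_EE \<alpha> k l * V
      = transpose_mat V * (transpose_mat (block_EE \<alpha> k l) * X k l * block_EE \<alpha> k l) * V"
      if kl: "k < l" "l < length \<alpha>" for k l
    proof -
      let ?q = "\<alpha> ! k + \<alpha> ! l" and ?E = "block_EE \<alpha> k l"
      have c: "transpose_mat V \<in> carrier_mat n n" "transpose_mat ?E \<in> carrier_mat n ?q"
        "X k l \<in> carrier_mat ?q ?q" "?E \<in> carrier_mat ?q n"
        using V EE[of k l] X[OF kl] by auto
      have "transpose_mat V * transpose_mat ?E * X k l = transpose_mat V * (transpose_mat ?E * X k l)"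
        by (rule assoc_mult_mat[OF c(1-3)])
      moreover have "transpose_mat V * (transpose_mat ?E * X k l) * ?E
        = transpose_mat V * (transpose_mat ?E * X k l * ?E)"
        by (rule assoc_mult_mat[OF c(1) mult_carrier_mat[OF c(2,3)] c(4)])
      ultimately show ?thesis by simp
    qed
    then show "(case x of (k, l) \<Rightarrow> transpose_mat V * transpose_mat (block_EE \<alpha> k l) * X k l
        * block_EE \<alpha> k l * V) = transpose_mat V * ?f x * V" if "x \<in> ?I" for x
      using that by auto
    show "(\<lambda>x. transpose_mat V * ?f x * V) \<in> ?I \<rightarrow> carrier (module_mat TYPE(real) n n)"
    proof
      fix x assume "x \<in> ?I"
      then have "transpose_mat V * ?f x * V \<in> carrier_mat n n"
        using V f by (meson mult_carrier_mat transpose_carrier_mat)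
      then show "transpose_mat V * ?f x * V \<in> carrier (module_mat TYPE(real) n n)"
        by (simp add: module_mat_simps)
    qed
  qed
  also have "\<dots> = transpose_mat V * finsum (module_mat TYPE(real) n n) ?f ?I * V"
    by (rule finsum_mat_congruence[OF finite_pairs f V])
  finally show ?thesis .
qed

lemma block_comb_psd:
  assumes "sum_list \<alpha> = n" and V: "V \<in> carrier_mat n n"
    and X: "\<And>k l. k < l \<Longrightarrow> l < length \<alpha> \<Longrightarrow> X k l \<in> psd_mats (\<alpha> ! k + \<alpha> ! l)"
  shows "block_comb n \<alpha> V X \<in> psd_mats n"
proof -
  have Xc: "X k l \<in> carrier_mat (\<alpha> ! k + \<alpha> ! l) (\<alpha> ! k + \<alpha> ! l)" if "k < l" "l < length \<alpha>" for k l
    using X[OF that] by (simp add: psd_mats_def sym_mats_def)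
  have "finsum (module_mat TYPE(real) n n)
      (\<lambda>(k, l). transpose_mat (block_EE \<alpha> k l) * X k l * block_EE \<alpha> k l)
      {(k, l). k < l \<and> l < length \<alpha>} \<in> psd_mats n"
  proof (intro psd_mats_finsum finite_pairs, clarify)
    fix k l assume "k < l" "l < length \<alpha>"
    from psd_mats_congruence[OF X[OF this] block_EE_carrier]
    show "transpose_mat (block_EE \<alpha> k l) * X k l * block_EE \<alpha> k l \<in> psd_mats n"
      by (simp add: assms(1))
  qed
  from psd_mats_congruence[OF this V] show ?thesis
    by (simp add: block_comb_eq_congruence[OF assms(1) V Xc])
qed

text \<open>
  Adding up the principal submatrices of \<open>B\<close> belonging to all pairs of blocks counts an entry
  once for every pair containing the blocks of its row and its column: once off the diagonal
  blocks, and \<open>p - 1\<close> times on them.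
\<close>

lemma block_comb_compress:
  assumes n: "sum_list \<alpha> = n" and V: "V \<in> carrier_mat n n" and B: "B \<in> carrier_mat n n"
  shows "block_comb n \<alpha> V (\<lambda>k l. block_EE \<alpha> k l * B * transpose_mat (block_EE \<alpha> k l))
    = transpose_mat V * mat n n (\<lambda>(i, j). if block_of \<alpha> i = block_of \<alpha> j
        then real (length \<alpha> - 1) * B $$ (i, j) else B $$ (i, j)) * V"
proof -
  let ?I = "{(k, l). k < l \<and> l < length \<alpha>}"
  let ?f = "\<lambda>(k, l). transpose_mat (block_EE \<alpha> k l)
    * (block_EE \<alpha> k l * B * transpose_mat (block_EE \<alpha> k l)) * block_EE \<alpha> k l"
  let ?D = "mat n n (\<lambda>(i, j). if block_of \<alpha> i = block_of \<alpha> j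
        then real (length \<alpha> - 1) * B $$ (i, j) else B $$ (i, j))"
  let ?S = "finsum (module_mat TYPE(real) n n) ?f ?I"
  have EE: "block_EE \<alpha> k l \<in> carrier_mat (\<alpha> ! k + \<alpha> ! l) n" for k l
    using block_EE_carrier[of \<alpha> k l] n by simp
  have f: "?f (k, l) = mat n n (\<lambda>(i, j).
      if block_of \<alpha> i \<in> {k, l} \<and> block_of \<alpha> j \<in> {k, l} then B $$ (i, j) else 0)"
    if "(k, l) \<in> ?I" for k l
    using block_EE_compress[of k \<alpha> l B] that B n by auto
  have fc: "?f x \<in> carrier_mat n n" if "x \<in> ?I" for x
  proof -
    obtain k l where x: "x = (k, l)" by (cases x)
    show ?thesis unfolding x by (subst f) (use that x in auto)
  qed
  have "?S = ?D"
  proof (rule eq_matI)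
    have S: "?S \<in> carrier_mat n n" by (rule finsum_mat_carrier[OF finite_pairs fc])
    show "dim_row ?S = dim_row ?D" "dim_col ?S = dim_col ?D" using S by auto
    fix i j assume "i < dim_row ?D" "j < dim_col ?D"
    then have ij: "i < n" "j < n" by auto
    have "?S $$ (i, j) = (\<Sum>x\<in>?I. ?f x $$ (i, j))"
      by (rule index_finsum_mat[OF finite_pairs fc ij])
    also have "\<dots> = (\<Sum>x\<in>?I. if block_of \<alpha> i \<in> {fst x, snd x} \<and> block_of \<alpha> j \<in> {fst x, snd x}
        then B $$ (i, j) else 0)"
    proof (rule sum.cong[OF refl])
      fix x assume "x \<in> ?I"
      moreover obtain k l where "x = (k, l)" by (cases x)
      ultimately show "?f x $$ (i, j) = (if block_of \<alpha> i \<in> {fst x, snd x}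
          \<and> block_of \<alpha> j \<in> {fst x, snd x} then B $$ (i, j) else 0)"
        using f[of k l] ij by (simp only: fst_conv snd_conv) simp
    qed
    also have "\<dots> = (\<Sum>x\<in>{x \<in> ?I. block_of \<alpha> i \<in> {fst x, snd x} \<and> block_of \<alpha> j \<in> {fst x, snd x}}.
        B $$ (i, j))"
      by (rule sum.inter_filter[OF finite_pairs, symmetric])
    also have "{x \<in> ?I. block_of \<alpha> i \<in> {fst x, snd x} \<and> block_of \<alpha> j \<in> {fst x, snd x}}
      = {(k, l). k < l \<and> l < length \<alpha> \<and> block_of \<alpha> i \<in> {k, l} \<and> block_of \<alpha> j \<in> {k, l}}"
      by auto
    also have "(\<Sum>x\<in>\<dots>. B $$ (i, j)) = ?D $$ (i, j)"
      using ij n by (simp add: card_pairs_containing block_of_less del: insert_iff)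
    finally show "?S $$ (i, j) = ?D $$ (i, j)" .
  qed
  moreover have "block_EE \<alpha> k l * B * transpose_mat (block_EE \<alpha> k l)
      \<in> carrier_mat (\<alpha> ! k + \<alpha> ! l) (\<alpha> ! k + \<alpha> ! l)" for k l
    using EE[of k l] B by auto
  ultimately show ?thesis by (simp add: block_comb_eq_congruence[OF n V])
qed

text \<open>
  The identity is interior to the cone of block-pair combinations. The step \<open>\<epsilon>\<close> is
  chosen so that the diagonal part \<open>(1 - \<epsilon>) / (p - 1)\<close> of the reweighted matrix is exactly
  \<open>\<epsilon>\<close> times the entrywise norm \<open>K\<close> of the reweighted \<open>W\<close>.
\<close>

lemma near_identity_block_comb:
  assumes n: "sum_list \<alpha> = n" and p: "2 \<le> length \<alpha>"
    and V: "V \<in> carrier_mat n n" and W: "W \<in> sym_mats n"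
  shows "\<exists>\<epsilon> X. 0 < \<epsilon> \<and> \<epsilon> \<le> 1
    \<and> (\<forall>k l. k < l \<and> l < length \<alpha> \<longrightarrow> X k l \<in> psd_mats (\<alpha> ! k + \<alpha> ! l))
    \<and> block_comb n \<alpha> V X = transpose_mat V * ((1 - \<epsilon>) \<cdot>\<^sub>m 1\<^sub>m n + \<epsilon> \<cdot>\<^sub>m W) * V"
proof -
  define r where "r = real (length \<alpha> - 1)"
  have r: "0 < r" using p by (simp add: r_def)
  define W' where "W' = mat n n (\<lambda>(i, j). if block_of \<alpha> i = block_of \<alpha> j
    then W $$ (i, j) / r else W $$ (i, j))"
  define K where "K = (\<Sum>i<n. \<Sum>j<n. \<bar>W' $$ (i, j)\<bar>)"
  have K: "0 \<le> K" unfolding K_def by (intro sum_nonneg) auto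
  define \<epsilon> where "\<epsilon> = 1 / (1 + r * K)"
  have pos: "0 < 1 + r * K" using r K by (simp add: add_pos_nonneg)
  have \<epsilon>: "0 < \<epsilon>" "\<epsilon> \<le> 1" using r K pos by (auto simp: \<epsilon>_def)
  have "\<epsilon> * (1 + r * K) = 1" using pos by (simp add: \<epsilon>_def)
  then have bal: "\<epsilon> * K = (1 - \<epsilon>) / r" using r by (simp add: field_simps)
  define B where "B = ((1 - \<epsilon>) / r) \<cdot>\<^sub>m 1\<^sub>m n + \<epsilon> \<cdot>\<^sub>m W'"
  have Wc: "W \<in> carrier_mat n n" using W by (simp add: sym_mats_def)
  have W'c: "W' \<in> carrier_mat n n" by (simp add: W'_def)
  have "\<epsilon> \<cdot>\<^sub>m W' \<in> sym_mats n"
    using W unfolding sym_mats_iff by (auto simp: W'_def)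
  moreover have "(\<Sum>i<n. \<Sum>j<n. \<bar>(\<epsilon> \<cdot>\<^sub>m W') $$ (i, j)\<bar>) = \<epsilon> * K"
    unfolding K_def sum_distrib_left using W'c \<epsilon> by (intro sum.cong refl) (auto simp: abs_mult)
  ultimately have Bpsd: "B \<in> psd_mats n"
    unfolding B_def by (intro psd_mats_scaled_id_add) (simp_all add: bal)
  have Bc: "B \<in> carrier_mat n n" using W'c by (simp add: B_def)
  let ?X = "\<lambda>k l. block_EE \<alpha> k l * B * transpose_mat (block_EE \<alpha> k l)"
  have "?X k l \<in> psd_mats (\<alpha> ! k + \<alpha> ! l)" for k l
    using psd_mats_congruence[OF Bpsd, of "transpose_mat (block_EE \<alpha> k l)"]
      block_EE_carrier[of \<alpha> k l] n by simp
  moreover have "mat n n (\<lambda>(i, j). if block_of \<alpha> i = block_of \<alpha> j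
      then real (length \<alpha> - 1) * B $$ (i, j) else B $$ (i, j))
    = (1 - \<epsilon>) \<cdot>\<^sub>m 1\<^sub>m n + \<epsilon> \<cdot>\<^sub>m W"
    unfolding r_def[symmetric] using r Wc
    by (intro eq_matI) (auto simp: B_def W'_def field_simps)
  ultimately show ?thesis
    using \<epsilon> block_comb_compress[OF n V Bc] by (intro exI[of _ \<epsilon>] exI[of _ ?X]) simp
qed

section \<open>Comparing the outer problem with the dual\<close>

lemma out_feasible_imp_dual_feasible:
  assumes C: "C \<in> carrier_mat n n" and A: "\<And>i. i < m \<Longrightarrow> A i \<in> sym_mats n"
    and n: "sum_list \<alpha> = n" and V: "V \<in> carrier_mat n n"
    and out: "out_feasible n m A C \<alpha> V y X"
  shows "dual_feasible n m A C y (C - lin_comb n m A y)"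
proof -
  note L = lin_comb_carrier[of m A n y, OF A]
  have "block_comb n \<alpha> V X \<in> psd_mats n"
    using out by (intro block_comb_psd[OF n V]) (auto simp: out_feasible_def)
  moreover have "C - lin_comb n m A y + lin_comb n m A y = C"
    using C L by (intro eq_matI) auto
  ultimately show ?thesis using out by (simp add: out_feasible_def dual_feasible_def)
qed

lemma out_value_le_dual_value:
  assumes "C \<in> carrier_mat n n" "\<And>i. i < m \<Longrightarrow> A i \<in> sym_mats n"
    and "sum_list \<alpha> = n" "V \<in> carrier_mat n n"
  shows "out_value n m A b C \<alpha> V \<le> dual_value n m A b C"
  unfolding out_value_def dual_value_def
proof (rule Sup_subset_mono, clarify)
  fix y X assume "out_feasible n m A C \<alpha> V y X"
  from out_feasible_imp_dual_feasible[OF assms this]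
  show "\<exists>y' Z. ereal (b \<bullet> y) = ereal (b \<bullet> y') \<and> dual_feasible n m A C y' Z" by blast
qed

lemma out_value_eq_optimal:
  assumes "out_optimal n m A b C \<alpha> V y X"
  shows "out_value n m A b C \<alpha> V = ereal (b \<bullet> y)"
  unfolding out_value_def
proof (rule antisym)
  show "Sup {ereal (b \<bullet> y) | y X. out_feasible n m A C \<alpha> V y X} \<le> ereal (b \<bullet> y)"
    using assms by (intro Sup_least) (auto simp: out_optimal_def)
  show "ereal (b \<bullet> y) \<le> Sup {ereal (b \<bullet> y) | y X. out_feasible n m A C \<alpha> V y X}"
    using assms by (intro Sup_upper) (auto simp: out_optimal_def)
qed

lemma slack_convex_combination:
  assumes C: "C \<in> carrier_mat n n" and A: "\<And>i. i < m \<Longrightarrow> A i \<in> sym_mats n"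
    and y: "y \<in> carrier_vec m" "y' \<in> carrier_vec m"
  shows "C - lin_comb n m A ((1 - \<epsilon>) \<cdot>\<^sub>v y + \<epsilon> \<cdot>\<^sub>v y')
    = (1 - \<epsilon>) \<cdot>\<^sub>m (C - lin_comb n m A y) + \<epsilon> \<cdot>\<^sub>m (C - lin_comb n m A y')" (is "?L = ?R")
proof (rule eq_matI)
  note L = lin_comb_carrier[of m A n, OF A]
  show "dim_row ?L = dim_row ?R" "dim_col ?L = dim_col ?R"
    using L[of y'] L[of "(1 - \<epsilon>) \<cdot>\<^sub>v y + \<epsilon> \<cdot>\<^sub>v y'"] by auto
  fix i j assume "i < dim_row ?R" "j < dim_col ?R"
  then have ij: "i < n" "j < n" using L[of y'] by auto
  have ix: "lin_comb n m A z $$ (i, j) = (\<Sum>k<m. z $ k * A k $$ (i, j))" for z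
    by (rule index_lin_comb[OF A ij])
  have "lin_comb n m A ((1 - \<epsilon>) \<cdot>\<^sub>v y + \<epsilon> \<cdot>\<^sub>v y') $$ (i, j)
    = (\<Sum>k<m. (1 - \<epsilon>) * (y $ k * A k $$ (i, j)) + \<epsilon> * (y' $ k * A k $$ (i, j)))"
    unfolding ix
    using y by (intro sum.cong) (auto simp: algebra_simps)
  also have "\<dots> = (1 - \<epsilon>) * lin_comb n m A y $$ (i, j) + \<epsilon> * lin_comb n m A y' $$ (i, j)"
    unfolding ix by (simp add: sum.distrib sum_distrib_left)
  finally show "?L $$ (i, j) = ?R $$ (i, j)"
    using ij C L[of y] L[of y'] L[of "(1 - \<epsilon>) \<cdot>\<^sub>v y + \<epsilon> \<cdot>\<^sub>v y'"]
    by (simp add: algebra_simps)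
qed

text \<open>
  The improvement step. In the coordinates given by the factor \<open>V\<close> of the current slack, that
  slack is the identity, so every direction leading to a dual feasible point stays
  feasible for a positive time.
\<close>

lemma out_feasible_step_towards_dual_feasible:
  assumes C: "C \<in> carrier_mat n n" and A: "\<And>i. i < m \<Longrightarrow> A i \<in> sym_mats n"
    and n: "sum_list \<alpha> = n" and p: "2 \<le> length \<alpha>" and y: "y \<in> carrier_vec m"
    and pd: "C - lin_comb n m A y \<in> pd_mats n"
    and V: "cholesky_factor n (C - lin_comb n m A y) V"
    and dual: "dual_feasible n m A C y' Z"
  shows "\<exists>\<epsilon> X. 0 < \<epsilon> \<and> \<epsilon> \<le> 1 \<and> out_feasible n m A C \<alpha> V ((1 - \<epsilon>) \<cdot>\<^sub>v y + \<epsilon> \<cdot>\<^sub>v y') X"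
proof -
  have y': "y' \<in> carrier_vec m" and Z: "Z \<in> sym_mats n" "Z \<in> carrier_mat n n"
    and Ceq: "Z + lin_comb n m A y' = C"
    using dual by (auto simp: dual_feasible_def psd_mats_def sym_mats_def)
  have Vc: "V \<in> carrier_mat n n" "transpose_mat V \<in> carrier_mat n n"
    and MV: "C - lin_comb n m A y = transpose_mat V * V"
    using V by (auto simp: cholesky_factor_def)
  obtain U where U: "U \<in> carrier_mat n n" "V * U = 1\<^sub>m n" "U * V = 1\<^sub>m n"
    using cholesky_factor_invertible[OF pd V] by auto
  define W where "W = transpose_mat U * Z * U"
  have W: "W \<in> sym_mats n" unfolding W_def by (rule sym_mats_congruence[OF Z(1) U(1)])
  then have Wc: "W \<in> carrier_mat n n" by (simp add: sym_mats_def)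
  obtain \<epsilon> X where \<epsilon>: "0 < \<epsilon>" "\<epsilon> \<le> 1"
    and X: "\<forall>k l. k < l \<and> l < length \<alpha> \<longrightarrow> X k l \<in> psd_mats (\<alpha> ! k + \<alpha> ! l)"
    and comb: "block_comb n \<alpha> V X = transpose_mat V * ((1 - \<epsilon>) \<cdot>\<^sub>m 1\<^sub>m n + \<epsilon> \<cdot>\<^sub>m W) * V"
    using near_identity_block_comb[OF n p Vc(1) W] by auto
  have VWV: "transpose_mat V * W * V = Z"
  proof -
    have TU: "transpose_mat U \<in> carrier_mat n n" using U by simp
    have TZ: "transpose_mat U * Z \<in> carrier_mat n n" using TU Z(2) by (rule mult_carrier_mat)
    have "transpose_mat V * W * V = transpose_mat V * (W * V)"
      by (rule assoc_mult_mat[OF Vc(2) Wc Vc(1)])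
    also have "W * V = transpose_mat U * Z * (U * V)"
      unfolding W_def by (rule assoc_mult_mat[OF TZ U(1) Vc(1)])
    also have "\<dots> = transpose_mat U * Z" unfolding U(3) by (rule right_mult_one_mat[OF TZ])
    also have "transpose_mat V * (transpose_mat U * Z) = transpose_mat V * transpose_mat U * Z"
      by (rule assoc_mult_mat[OF Vc(2) TU Z(2), symmetric])
    also have "transpose_mat V * transpose_mat U = 1\<^sub>m n"
      using transpose_mult[OF U(1) Vc(1)] by (simp add: U(3))
    finally show ?thesis using Z(2) by simp
  qed
  have "transpose_mat V * ((1 - \<epsilon>) \<cdot>\<^sub>m 1\<^sub>m n + \<epsilon> \<cdot>\<^sub>m W)
    = (1 - \<epsilon>) \<cdot>\<^sub>m transpose_mat V + \<epsilon> \<cdot>\<^sub>m (transpose_mat V * W)"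
    using Vc Wc by (simp add: mult_add_distrib_mat[of _ n n _ n] mult_smult_distrib[of _ n n _ n])
  then have "block_comb n \<alpha> V X
    = (1 - \<epsilon>) \<cdot>\<^sub>m (transpose_mat V * V) + \<epsilon> \<cdot>\<^sub>m (transpose_mat V * W * V)"
    unfolding comb using Vc Wc
    by (simp add: add_mult_distrib_mat[of _ n n _ _ n] mult_smult_assoc_mat[of _ n n _ n])
  also have "\<dots> = (1 - \<epsilon>) \<cdot>\<^sub>m (C - lin_comb n m A y) + \<epsilon> \<cdot>\<^sub>m (C - lin_comb n m A y')"
  proof -
    have "C - lin_comb n m A y' = Z"
      using Z(2) lin_comb_carrier[of m A n y', OF A] by (subst Ceq[symmetric], intro eq_matI) auto
    then show ?thesis by (simp add: VWV MV)
  qed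
  also have "\<dots> = C - lin_comb n m A ((1 - \<epsilon>) \<cdot>\<^sub>v y + \<epsilon> \<cdot>\<^sub>v y')"
    by (rule slack_convex_combination[OF C A y y', symmetric])
  finally have "out_feasible n m A C \<alpha> V ((1 - \<epsilon>) \<cdot>\<^sub>v y + \<epsilon> \<cdot>\<^sub>v y') X"
    using X y y' by (simp add: out_feasible_def)
  with \<epsilon> show ?thesis by blast
qed

text \<open>
  With fewer than two blocks there is no pair of blocks, so an outer-feasible slack is zero, which is not
  positive definite as \<open>n > 0\<close>.
\<close>

lemma out_feasible_pd_imp_two_blocks:
  assumes "n \<noteq> 0"
    and out: "out_feasible n m A C \<alpha> V y X"
    and pd: "C - lin_comb n m A y \<in> pd_mats n"
  shows "2 \<le> length \<alpha>"
proof (rule ccontr)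
  assume "\<not> 2 \<le> length \<alpha>"
  then have I: "{(k, l). k < l \<and> l < length \<alpha>} = {}" by auto
  interpret abelian_group "module_mat TYPE(real) n n" by (rule abelian_group_mat)
  have "C - lin_comb n m A y = 0\<^sub>m n n"
    using out by (simp add: out_feasible_def block_comb_def I module_mat_simps)
  moreover have "unit_vec n 0 \<noteq> (0\<^sub>v n :: real vec)"
    using \<open>n \<noteq> 0\<close> by (metis index_unit_vec(1) index_zero_vec(1) neq0_conv zero_neq_one)
  ultimately have "0 < unit_vec n 0 \<bullet> (0\<^sub>m n n *\<^sub>v (unit_vec n 0 :: real vec))"
    using pd by (simp add: pd_mats_def)
  then show False by (simp add: quadratic_form_sum[of _ n])
qed

theorem theorem3:
  fixes n m t :: nat
    and A :: "nat \<Rightarrow> real mat" and C :: "real mat" and b :: "real vec"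
    and \<alpha> :: "nat list"
    and V :: "nat \<Rightarrow> real mat" and y :: "nat \<Rightarrow> real vec"
    and X :: "nat \<Rightarrow> nat \<Rightarrow> nat \<Rightarrow> real mat"
  assumes "C \<in> sym_mats n"
    and "\<And>i. i < m \<Longrightarrow> A i \<in> sym_mats n"
    and "b \<in> carrier_vec m"
    and "primal_value n m A b C = dual_value n m A b C"
    and "partition_of \<alpha> n"
    and "V 1 = 1\<^sub>m n"
    and "\<And>s. 1 \<le> s \<Longrightarrow> out_optimal n m A b C \<alpha> (V s) (y s) (X s)"
    and "\<And>s. 1 \<le> s \<Longrightarrow> cholesky_factor n (C - lin_comb n m A (y s)) (V (s + 1))"
    and "1 \<le> t"
    and "C - lin_comb n m A (y t) \<in> pd_mats n"
    and "out_value n m A b C \<alpha> (V t) < dual_value n m A b C"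
  shows "out_value n m A b C \<alpha> (V t) < out_value n m A b C \<alpha> (V (t + 1)) \<and>
         out_value n m A b C \<alpha> (V (t + 1)) \<le> dual_value n m A b C"
proof
  have C: "C \<in> carrier_mat n n" using assms(1) by (simp add: sym_mats_def)
  have n: "sum_list \<alpha> = n" using assms(5) by (simp add: partition_of_def)
  have chol: "cholesky_factor n (C - lin_comb n m A (y t)) (V (t + 1))"
    by (rule assms(8)[OF assms(9)])
  then have V: "V (t + 1) \<in> carrier_mat n n" by (simp add: cholesky_factor_def)
  have opt: "out_optimal n m A b C \<alpha> (V t) (y t) (X t)" by (rule assms(7)[OF assms(9)])
  then have out: "out_feasible n m A C \<alpha> (V t) (y t) (X t)" by (simp add: out_optimal_def)
  then have yt: "y t \<in> carrier_vec m" by (simp add: out_feasible_def)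
  have val: "out_value n m A b C \<alpha> (V t) = ereal (b \<bullet> y t)" by (rule out_value_eq_optimal[OF opt])
  show "out_value n m A b C \<alpha> (V (t + 1)) \<le> dual_value n m A b C"
    by (rule out_value_le_dual_value[OF C assms(2) n V])
  obtain y' Z where dual: "dual_feasible n m A C y' Z" and gt: "b \<bullet> y t < b \<bullet> y'"
    using assms(11) unfolding val dual_value_def less_Sup_iff by auto
  have y': "y' \<in> carrier_vec m" using dual by (simp add: dual_feasible_def)
  have "\<exists>z X'. out_feasible n m A C \<alpha> (V (t + 1)) z X' \<and> b \<bullet> y t < b \<bullet> z"
  proof (cases "n = 0")
    case True
    \<comment> \<open>All \<open>0 \<times> 0\<close> matrices are equal, so \<open>y'\<close> itself is feasible.\<close>
    then have "\<alpha> = []" using assms(5) by (cases \<alpha>) (auto simp: partition_of_def)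
    then have "block_comb n \<alpha> (V (t + 1)) (X t) \<in> psd_mats n"
      by (intro block_comb_psd[OF n V]) simp
    then have "block_comb n \<alpha> (V (t + 1)) (X t) \<in> carrier_mat n n"
      by (simp add: psd_mats_def sym_mats_def)
    then have "C - lin_comb n m A y' = block_comb n \<alpha> (V (t + 1)) (X t)"
      using True lin_comb_carrier[of m A n y', OF assms(2)] by (intro eq_matI) auto
    then have "out_feasible n m A C \<alpha> (V (t + 1)) y' (X t)"
      using y' \<open>\<alpha> = []\<close> by (simp add: out_feasible_def)
    with gt show ?thesis by blast
  next
    case False
    have p: "2 \<le> length \<alpha>"
      by (rule out_feasible_pd_imp_two_blocks[OF False out assms(10)])
    obtain \<epsilon> X' where \<epsilon>: "0 < \<epsilon>"
      and feas: "out_feasible n m A C \<alpha> (V (t + 1)) ((1 - \<epsilon>) \<cdot>\<^sub>v y t + \<epsilon> \<cdot>\<^sub>v y') X'"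
      using out_feasible_step_towards_dual_feasible[OF C assms(2) n p yt assms(10) chol dual] by auto
    have "b \<bullet> ((1 - \<epsilon>) \<cdot>\<^sub>v y t + \<epsilon> \<cdot>\<^sub>v y') = (1 - \<epsilon>) * (b \<bullet> y t) + \<epsilon> * (b \<bullet> y')"
      using assms(3) yt y' by (simp add: scalar_prod_add_distrib[of _ m])
    moreover have "\<epsilon> * (b \<bullet> y t) < \<epsilon> * (b \<bullet> y')" using gt \<epsilon> by simp
    ultimately have "b \<bullet> y t < b \<bullet> ((1 - \<epsilon>) \<cdot>\<^sub>v y t + \<epsilon> \<cdot>\<^sub>v y')"
      by (simp add: algebra_simps)
    with feas show ?thesis by blast
  qed
  then obtain z X' where z: "out_feasible n m A C \<alpha> (V (t + 1)) z X'" "b \<bullet> y t < b \<bullet> z" by blast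
  have "ereal (b \<bullet> y t) < ereal (b \<bullet> z)" using z(2) by simp
  also have "\<dots> \<le> out_value n m A b C \<alpha> (V (t + 1))"
    unfolding out_value_def using z(1) by (intro Sup_upper) auto
  finally show "out_value n m A b C \<alpha> (V t) < out_value n m A b C \<alpha> (V (t + 1))"
    unfolding val .
qed

end
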